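(* With quaternionic multiplication $\times$ and the differential operators $L_q=(\partial_x+i\partial_y,\ \partial_z+i\partial_u)$ and $L_q^{*}=(\partial_x-i\partial_y,\ -\partial_z-i\partial_u)$, the four-dimensional Laplace operator $\triangle_4=\partial_x^2+\partial_y^2+\partial_z^2+\partial_u^2$ factorizes as $$\triangle_4=L_q\times L_q^{*}=L_q^{*}\times L_q .$$ Consequently, for a function $\psi=(\phi_1,\phi_2)$, $$\triangle_4\times\psi=0\ \Leftarrow\ (L_q\times\psi=0)\ \vee\ (L_q^{*}\times\psi=0),$$ that is, if $\psi$ satisfies $L_q\times\psi=0$ or $L_q^{*}\times\psi=0$, then $\partial_x^2\psi+\partial_y^2\psi+\partial_z^2\psi+\partial_u^2\psi=0$. Moreover, $L_q\times\psi=0$ is equivalent to the simultaneous validity of the equations $$D_a\cdot\phi_1=D_b\cdot\phi_2^{*},\qquad D_b\cdot\phi_1^{*}=-D_a\cdot\phi_2,$$ and $L_q^{*}\times\psi=0$ is equivalent to the simultaneous validity of the equations $$D_a^{*}\cdot\phi_1=-D_b\cdot\phi_2^{*},\qquad D_b\cdot\phi_1^{*}=D_a^{*}\cdot\phi_2 .$$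
   Context: Quaternions are represented by pairs of complex numbers with multiplication $(a,b)\times(c,d)=(ac-bd^{*},\ bc^{*}+ad)$ and conjugation $(a,b)^{*}=(a^{*},-b)$, where $^{*}$ on complex numbers (and complex-valued functions and operators) is complex conjugation. The function $\psi$ has the form $\psi(p)=(\phi_1(a,b),\phi_2(a,b))$ for $p=(a,b)$, $a=x+iy$, $b=z+iu$, where $\phi_1=\psi_1+i\psi_2$ and $\phi_2=\psi_3+i\psi_4$ with $\psi_1,\dots,\psi_4$ real-valued functions of the real variables $x,y,z,u$. The operators are $D_a=\partial_x+i\partial_y$, $D_b=\partial_z+i\partial_u$, $D_a^{*}=\partial_x-i\partial_y$, so $L_q=(D_a,D_b)$ and $L_q^{*}=(D_a^{*},-D_b)$. The product of an operator pair with a function pair (or with another operator pair) is formed by the same formula as quaternionic multiplication, with differential operators applied to functions, e.g. $L_q\times\psi=(D_a\cdot\phi_1-D_b\cdot\phi_2^{*},\ D_b\cdot\phi_1^{*}+D_a\cdot\phi_2)$. $\triangle_4$ is regarded as a scalar quaternion, i.e. as the pair $(\triangle_4,0)$, so that $\triangle_4\times\psi$ applies it to each component of $\psi$. *)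

theory Defs
  imports "HOL-Analysis.Analysis" "HOL-Library.Function_Algebras"
begin

(* The pair (a, b) stands for the quaternion a + b j; with a = x + i y and b = z + i u,
   the coordinate directions x, y, z, u are exactly the elements of Basis. *)
type_synonym quat = "complex \<times> complex"
type_synonym cfun = "quat \<Rightarrow> complex"
type_synonym cop = "cfun \<Rightarrow> cfun"

definition pd :: "quat \<Rightarrow> (quat \<Rightarrow> 'a::real_normed_vector) \<Rightarrow> quat \<Rightarrow> 'a" where
  "pd e f p = vector_derivative (\<lambda>t. f (p + t *\<^sub>R e)) (at 0)"

abbreviation "pdx \<equiv> pd (1, 0)"
abbreviation "pdy \<equiv> pd (\<i>, 0)"
abbreviation "pdz \<equiv> pd (0, 1)"
abbreviation "pdu \<equiv> pd (0, \<i>)"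

(* All iterated partial derivatives of order at most k exist and are continuous on S
   (intended for open S). *)
primrec Ck_on :: "nat \<Rightarrow> quat set \<Rightarrow> (quat \<Rightarrow> 'a::real_normed_vector) \<Rightarrow> bool" where
  "Ck_on 0 S f \<longleftrightarrow> continuous_on S f"
| "Ck_on (Suc k) S f \<longleftrightarrow> continuous_on S f \<and>
     (\<forall>e\<in>Basis. (\<forall>p\<in>S. (\<lambda>t. f (p + t *\<^sub>R e)) differentiable (at 0)) \<and> Ck_on k S (pd e f))"

(* The product (a, b) (c, d) = (a c - b d^*, b c^* + a d), for entries multiplied by m and
   conjugated by cj, where d^* means cj d.  Sums, differences and zeros of functions and of
   operators are pointwise. *)
fun cd_mult :: "('a \<Rightarrow> 'b \<Rightarrow> 'c::{plus,minus}) \<Rightarrow> ('b \<Rightarrow> 'b) \<Rightarrow> 'a \<times> 'a \<Rightarrow> 'b \<times> 'b \<Rightarrow> 'c \<times> 'c" where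
  "cd_mult m cj (a, b) (c, d) = (m a c - m b (cj d), m b (cj c) + m a d)"

definition quat_mult :: "quat \<Rightarrow> quat \<Rightarrow> quat" where
  "quat_mult = cd_mult (*) cnj"

definition fun_cnj :: "cfun \<Rightarrow> cfun" where
  "fun_cnj f = (\<lambda>p. cnj (f p))"

(* A conjugated operator sends f to the conjugate of A applied to the conjugate of f. *)
definition op_cnj :: "cop \<Rightarrow> cop" where
  "op_cnj A = (\<lambda>f. fun_cnj (A (fun_cnj f)))"

definition op_fun_mult :: "cop \<times> cop \<Rightarrow> cfun \<times> cfun \<Rightarrow> cfun \<times> cfun"  (infixr "\<times>\<^sub>f" 75) where
  "op_fun_mult = cd_mult (\<lambda>A f. A f) fun_cnj"

definition op_op_mult :: "cop \<times> cop \<Rightarrow> cop \<times> cop \<Rightarrow> cop \<times> cop"  (infixr "\<times>\<^sub>o" 75) where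
  "op_op_mult = cd_mult (\<circ>) op_cnj"

definition Da :: cop where "Da f p = pdx f p + \<i> * pdy f p"
definition Db :: cop where "Db f p = pdz f p + \<i> * pdu f p"
definition Da_star :: cop where "Da_star f p = pdx f p - \<i> * pdy f p"

definition Lq :: "cop \<times> cop" where "Lq = (Da, Db)"
definition Lq_star :: "cop \<times> cop" where "Lq_star = (Da_star, - Db)"

definition laplace4 :: cop where
  "laplace4 f p = pdx (pdx f) p + pdy (pdy f) p + pdz (pdz f) p + pdu (pdu f) p"

definition laplace4_pair :: "cop \<times> cop" where "laplace4_pair = (laplace4, 0)"

definition op_eq_on :: "quat set \<Rightarrow> cop \<times> cop \<Rightarrow> cop \<times> cop \<Rightarrow> bool" where
  "op_eq_on S P Q \<longleftrightarrow> (\<forall>f. Ck_on 2 S f \<longrightarrow>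
     (\<forall>p\<in>S. fst P f p = fst Q f p \<and> snd P f p = snd Q f p))"

definition zero_on :: "quat set \<Rightarrow> cfun \<times> cfun \<Rightarrow> bool" where
  "zero_on S F \<longleftrightarrow> (\<forall>p\<in>S. fst F p = 0 \<and> snd F p = 0)"

lemma Basis_quat: "(Basis :: quat set) = {(1, 0), (\<i>, 0), (0, 1), (0, \<i>)}"
  by (auto simp: Basis_prod_def Basis_complex_def)

lemma pd_cnj:
  assumes "(\<lambda>t. f (p + t *\<^sub>R e)) differentiable (at 0)"
  shows "pd e (fun_cnj f) p = cnj (pd e f p)"
proof -
  have "((\<lambda>t. f (p + t *\<^sub>R e)) has_vector_derivative pd e f p) (at 0)"
    using assms by (simp add: pd_def vector_derivative_works)
  then have "((\<lambda>t. cnj (f (p + t *\<^sub>R e))) has_vector_derivative cnj (pd e f p)) (at 0)"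
    by (rule has_vector_derivative_cnj)
  then show ?thesis
    by (simp add: pd_def fun_cnj_def vector_derivative_at)
qed

(* Justifies Da_star as the conjugate of the operator Da, where the partial derivatives exist. *)
lemma op_cnj_Da:
  assumes "Ck_on 1 S f" "p \<in> S"
  shows "op_cnj Da f p = Da_star f p"
  using assms by (simp add: op_cnj_def fun_cnj_def[of "Da _"] Da_def Da_star_def pd_cnj Basis_quat)

end

theory Submission
  imports Defs
begin

text \<open>
  The factorization amounts to \<open>D\<^sub>a D\<^sub>a\<^sup>* + D\<^sub>b D\<^sub>b\<^sup>* = \<triangle>\<^sub>4\<close> together with \<open>D\<^sub>a D\<^sub>b = D\<^sub>b D\<^sub>a\<close> and
  \<open>D\<^sub>a\<^sup>* D\<^sub>b = D\<^sub>b D\<^sub>a\<^sup>*\<close>, all of which rest on the symmetry of mixed partial derivatives. Operator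
  products with conjugation are compared with these on \<open>S\<close> only, where the derivatives exist; this
  suffices because \<open>S\<close> is open and derivatives are local. Harmonicity of the solutions follows by
  applying the conjugate operator to the first order system.
\<close>

text \<open>\<open>pd\<close> is total and does not record whether the derivative exists. This
  relation asserts existence and value together, so that the derivative rules compose.\<close>

definition has_pd :: "quat \<Rightarrow> (quat \<Rightarrow> 'a::real_normed_vector) \<Rightarrow> 'a \<Rightarrow> quat \<Rightarrow> bool" where
  "has_pd e f D p \<longleftrightarrow> ((\<lambda>t. f (p + t *\<^sub>R e)) has_vector_derivative D) (at 0)"

text \<open>The conjugate of the operator \<open>Db\<close>. It arises because the products
  conjugate the second entry of their right factor, and because equations involving conjugated
  functions get conjugated.\<close>

definition Db_star :: cop where "Db_star f p = pdz f p - \<i> * pdu f p"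

subsection \<open>Calculus of partial derivatives\<close>

lemma has_pd_imp_pd: "has_pd e f D p \<Longrightarrow> pd e f p = D"
  by (simp add: has_pd_def pd_def vector_derivative_at)

lemma has_pd_pd_iff: "has_pd e f (pd e f p) p \<longleftrightarrow> (\<lambda>t. f (p + t *\<^sub>R e)) differentiable (at 0)"
  by (simp add: has_pd_def pd_def vector_derivative_works)

lemma has_pd_add: "has_pd e f D p \<Longrightarrow> has_pd e g E p \<Longrightarrow> has_pd e (\<lambda>q. f q + g q) (D + E) p"
  by (simp add: has_pd_def has_vector_derivative_add)

lemma has_pd_diff: "has_pd e f D p \<Longrightarrow> has_pd e g E p \<Longrightarrow> has_pd e (\<lambda>q. f q - g q) (D - E) p"
  by (simp add: has_pd_def has_vector_derivative_diff)

lemma has_pd_minus: "has_pd e f D p \<Longrightarrow> has_pd e (\<lambda>q. - f q) (- D) p"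
  by (simp add: has_pd_def has_vector_derivative_minus)

lemma has_pd_mult_left:
  fixes f :: cfun
  shows "has_pd e f D p \<Longrightarrow> has_pd e (\<lambda>q. c * f q) (c * D) p"
  by (simp add: has_pd_def has_vector_derivative_mult_right)

lemma has_pd_cnj: "has_pd e f D p \<Longrightarrow> has_pd e (fun_cnj f) (cnj D) p"
  unfolding has_pd_def fun_cnj_def by (rule has_vector_derivative_cnj)

lemma has_pd_Pair:
  "has_pd e f D p \<Longrightarrow> has_pd e g E p \<Longrightarrow> has_pd e (\<lambda>q. (f q, g q)) (D, E) p"
  unfolding has_pd_def by (rule has_vector_derivative_Pair)

lemma has_pd_translate: "has_pd e f D (p + v) \<Longrightarrow> has_pd e (\<lambda>q. f (q + v)) D p"
  by (simp add: has_pd_def ac_simps)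

text \<open>\<open>has_pd\<close> only speaks of the parameter value 0; composing with the shift of
  the parameter by \<open>t\<close> reaches every point of the line.\<close>

lemma has_pd_along_line:
  assumes "has_pd e f D (c + t *\<^sub>R e)"
  shows "((\<lambda>s. f (c + s *\<^sub>R e)) has_vector_derivative D) (at t)"
proof -
  have "((\<lambda>s. s - t) has_vector_derivative 1) (at t)"
    by (auto intro!: derivative_eq_intros)
  moreover have "((\<lambda>s. f (c + t *\<^sub>R e + s *\<^sub>R e)) has_vector_derivative D) (at (t - t))"
    using assms by (simp add: has_pd_def)
  ultimately have "((\<lambda>s. f (c + t *\<^sub>R e + s *\<^sub>R e)) \<circ> (\<lambda>s. s - t) has_vector_derivative 1 *\<^sub>R D) (at t)"
    by (rule vector_diff_chain_at)
  then show ?thesis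
    by (simp add: o_def algebra_simps)
qed

text \<open>Since \<open>S\<close> is open, the line through \<open>p\<close> stays in
  \<open>S\<close> for small parameters, so both functions agree near 0 along it.\<close>

lemma has_pd_cong:
  assumes "open S" "p \<in> S" and eq: "\<And>q. q \<in> S \<Longrightarrow> f q = g q"
  shows "has_pd e f D p \<longleftrightarrow> has_pd e g D p"
proof -
  have "((\<lambda>t. p + t *\<^sub>R e) \<longlongrightarrow> p + 0 *\<^sub>R e) (nhds (0::real))"
    by (intro tendsto_intros filterlim_ident)
  then have "\<forall>\<^sub>F t in nhds (0::real). p + t *\<^sub>R e \<in> S"
    using assms(1,2) by (simp add: topological_tendstoD)
  then have "\<forall>\<^sub>F t in nhds (0::real). f (p + t *\<^sub>R e) = g (p + t *\<^sub>R e)"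
    by eventually_elim (rule eq)
  then show ?thesis
    unfolding has_pd_def by (intro has_vector_derivative_cong_ev) (auto simp: assms)
qed

text \<open>\<open>vector_derivative\<close> chooses among all derivatives, and the candidates for
  \<open>f\<close> and \<open>g\<close> are the same. The values thus agree even where no derivative
  exists.\<close>

lemma pd_cong:
  assumes "open S" "p \<in> S" "\<And>q. q \<in> S \<Longrightarrow> f q = g q"
  shows "pd e f p = pd e g p"
  using has_pd_cong[of S p f g e, OF assms]
  by (simp add: pd_def vector_derivative_def has_pd_def)

section \<open>Mean value estimates and symmetry of mixed partial derivatives\<close>

text \<open>Subtracting the linear function with slope \<open>L\<close> leaves a function whose
  derivative is bounded by \<open>B\<close>, to which the mean value inequality applies.\<close>

lemma pd_mean_value_bound:
  assumes "0 \<le> h"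
    and "\<And>t. t \<in> {0..h} \<Longrightarrow> has_pd e f (D (c + t *\<^sub>R e)) (c + t *\<^sub>R e)"
    and "\<And>t. t \<in> {0..h} \<Longrightarrow> norm (D (c + t *\<^sub>R e) - L) \<le> B"
  shows "norm (f (c + h *\<^sub>R e) - f c - h *\<^sub>R L) \<le> h * B"
proof -
  define g where "g t = f (c + t *\<^sub>R e) - t *\<^sub>R L" for t
  have "norm (g h - g 0) \<le> B * norm (h - 0)"
  proof (rule differentiable_bound[of "{0..h}"])
    fix t assume t: "t \<in> {0..h}"
    have "((\<lambda>s. f (c + s *\<^sub>R e)) has_vector_derivative D (c + t *\<^sub>R e)) (at t)"
      by (rule has_pd_along_line) (use assms(2) t in blast)
    then have "(g has_vector_derivative D (c + t *\<^sub>R e) - L) (at t)"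
      unfolding g_def by (auto intro!: derivative_eq_intros)
    then show "(g has_derivative (\<lambda>s. s *\<^sub>R (D (c + t *\<^sub>R e) - L))) (at t within {0..h})"
      by (simp add: has_vector_derivative_def has_derivative_at_withinI)
    show "onorm (\<lambda>s. s *\<^sub>R (D (c + t *\<^sub>R e) - L)) \<le> B"
      using assms(3)[OF t] by (intro onorm_le) (simp add: mult.commute[of B] mult_left_mono)
  qed (use assms(1) in auto)
  then show ?thesis
    using assms(1) by (simp add: g_def algebra_simps)
qed

text \<open>Two nested mean value estimates: the outer one in direction \<open>a\<close> for the
  difference of \<open>f\<close> over the step \<open>h *\<^sub>R b\<close>, the inner one in
  direction \<open>b\<close> for \<open>pd a f\<close>.\<close>

lemma second_difference_bound:
  assumes "0 \<le> h" "h * (norm a + norm b) < r"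
    and f1: "\<And>q. q \<in> ball p r \<Longrightarrow> has_pd a f (pd a f q) q"
    and f2: "\<And>q. q \<in> ball p r \<Longrightarrow> has_pd b (pd a f) (D q) q"
    and B: "\<And>q. q \<in> ball p r \<Longrightarrow> norm (D q - L) \<le> B"
  shows "norm (f (p + h *\<^sub>R a + h *\<^sub>R b) - f (p + h *\<^sub>R a) - (f (p + h *\<^sub>R b) - f p) - (h * h) *\<^sub>R L)
    \<le> h * h * B"
proof -
  \<comment> \<open>The whole parallelogram spanned by the two steps lies in the ball.\<close>
  have inball: "p + s *\<^sub>R a + t *\<^sub>R b \<in> ball p r" if "s \<in> {0..h}" "t \<in> {0..h}" for s t
  proof -
    have "norm (s *\<^sub>R a + t *\<^sub>R b) \<le> s * norm a + t * norm b"
      using that by (intro norm_triangle_le) simp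
    also have "\<dots> \<le> h * norm a + h * norm b"
      using that by (intro add_mono mult_right_mono) auto
    also have "\<dots> < r"
      using assms(2) by (simp add: algebra_simps)
    finally show ?thesis
      using dist_add_cancel[of p 0 "s *\<^sub>R a + t *\<^sub>R b"] by (simp add: add.assoc)
  qed
  let ?F = "\<lambda>q. f (q + h *\<^sub>R b) - f q"
  have "norm (?F (p + h *\<^sub>R a) - ?F p - h *\<^sub>R (h *\<^sub>R L)) \<le> h * (h * B)"
  proof (rule pd_mean_value_bound[where D = "\<lambda>q. pd a f (q + h *\<^sub>R b) - pd a f q"])
    fix s assume s: "s \<in> {0..h}"
    let ?q = "p + s *\<^sub>R a"
    have in1: "?q + t *\<^sub>R b \<in> ball p r" if "t \<in> {0..h}" for t
      using inball[OF s that] .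
    have in0: "?q \<in> ball p r" and inh: "?q + h *\<^sub>R b \<in> ball p r"
      using in1[of 0] in1[of h] assms(1) by simp_all
    show "has_pd a ?F (pd a f (?q + h *\<^sub>R b) - pd a f ?q) ?q"
      by (intro has_pd_diff has_pd_translate f1 in0 inh)
    show "norm (pd a f (?q + h *\<^sub>R b) - pd a f ?q - h *\<^sub>R L) \<le> h * B"
      by (rule pd_mean_value_bound[where D = D]) (use assms(1) f2 B in1 in auto)
  qed fact
  then show ?thesis
    by (simp add: algebra_simps)
qed

text \<open>Both iterated derivatives are limits of the same second difference quotient.\<close>

lemma mixed_pd_commute:
  assumes "open S" "p \<in> S"
    and "\<And>q. q \<in> S \<Longrightarrow> has_pd a f (pd a f q) q"
    and "\<And>q. q \<in> S \<Longrightarrow> has_pd b f (pd b f q) q"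
    and "\<And>q. q \<in> S \<Longrightarrow> has_pd b (pd a f) (pd b (pd a f) q) q"
    and "\<And>q. q \<in> S \<Longrightarrow> has_pd a (pd b f) (pd a (pd b f) q) q"
    and "continuous_on S (pd b (pd a f))" "continuous_on S (pd a (pd b f))"
  shows "pd a (pd b f) p = pd b (pd a f) p"
proof -
  let ?L = "pd b (pd a f) p" and ?M = "pd a (pd b f) p"
  have "norm (?M - ?L) \<le> e" if "e > 0" for e
  proof -
    have "\<forall>\<^sub>F q in nhds p. q \<in> S \<and> dist (pd b (pd a f) q) ?L < e / 2 \<and> dist (pd a (pd b f) q) ?M < e / 2"
    proof (intro eventually_conj)
      show "\<forall>\<^sub>F q in nhds p. q \<in> S"
        using assms(1,2) by (rule eventually_nhds_in_open)
      have "isCont (pd b (pd a f)) p" "isCont (pd a (pd b f)) p"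
        using assms by (auto simp: continuous_on_eq_continuous_at)
      then show "\<forall>\<^sub>F q in nhds p. dist (pd b (pd a f) q) ?L < e / 2"
        and "\<forall>\<^sub>F q in nhds p. dist (pd a (pd b f) q) ?M < e / 2"
        using \<open>e > 0\<close> tendstoD[of _ _ "nhds p" "e / 2"]
        by (simp_all add: isCont_def tendsto_at_iff_tendsto_nhds)
    qed
    then obtain r where "r > 0" and r: "\<And>q. q \<in> ball p r \<Longrightarrow>
        q \<in> S \<and> norm (pd b (pd a f) q - ?L) \<le> e / 2 \<and> norm (pd a (pd b f) q - ?M) \<le> e / 2"
      unfolding eventually_nhds_metric mem_ball
      by (force simp: dist_commute simp flip: dist_norm intro: less_imp_le)
    \<comment> \<open>The summand 1 keeps the denominator positive and makes
      \<open>h * (norm a + norm b)\<close> equal to \<open>r - h\<close>, strictly below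
      \<open>r\<close>.\<close>
    define h where "h = r / (norm a + norm b + 1)"
    have pos: "norm a + norm b + 1 > 0"
      by (simp add: add_nonneg_pos)
    then have "h > 0"
      using \<open>r > 0\<close> by (simp add: h_def)
    have "h * (norm a + norm b + 1) = r"
      using pos by (simp add: h_def)
    then have small: "h * (norm a + norm b) < r"
      using \<open>h > 0\<close> by (simp add: algebra_simps)
    define X where "X = f (p + h *\<^sub>R a + h *\<^sub>R b) - f (p + h *\<^sub>R a) - (f (p + h *\<^sub>R b) - f p)"
    have "norm (X - (h * h) *\<^sub>R ?L) \<le> h * h * (e / 2)"
      unfolding X_def
      by (rule second_difference_bound[where r = r and D = "pd b (pd a f)"])
        (use \<open>h > 0\<close> small r assms in auto)
    moreover have "norm (X - (h * h) *\<^sub>R ?M) \<le> h * h * (e / 2)"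
    proof -
      \<comment> \<open>The second difference is symmetric in \<open>a\<close> and \<open>b\<close>,
        so the same estimate applies with the directions exchanged.\<close>
      have X: "X = f (p + h *\<^sub>R b + h *\<^sub>R a) - f (p + h *\<^sub>R b) - (f (p + h *\<^sub>R a) - f p)"
        by (simp add: X_def algebra_simps)
      show ?thesis
        unfolding X
        by (rule second_difference_bound[where r = r and D = "pd a (pd b f)"])
          (use \<open>h > 0\<close> small r assms in \<open>auto simp: add.commute\<close>)
    qed
    ultimately have "norm ((X - (h * h) *\<^sub>R ?L) - (X - (h * h) *\<^sub>R ?M)) \<le> h * h * (e / 2) + h * h * (e / 2)"
      by (rule norm_triangle_le_diff[OF add_mono])
    moreover have "(X - (h * h) *\<^sub>R ?L) - (X - (h * h) *\<^sub>R ?M) = (h * h) *\<^sub>R (?M - ?L)"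
      by (simp add: algebra_simps)
    ultimately have "(h * h) * norm (?M - ?L) \<le> (h * h) * e"
      by (simp add: mult.commute[of e])
    then show ?thesis
      using \<open>h > 0\<close> by simp
  qed
  then show ?thesis
    using field_le_epsilon[of "norm (?M - ?L)" 0] by simp
qed

subsection \<open>Functions of class \<open>C\<^sup>k\<close>\<close>

lemma Ck_on_has_pd:
  assumes "Ck_on (Suc k) S f" "e \<in> Basis" "p \<in> S"
  shows "has_pd e f (pd e f p) p"
  using assms by (simp add: has_pd_pd_iff)

lemma Ck_on_pd: "Ck_on (Suc k) S f \<Longrightarrow> e \<in> Basis \<Longrightarrow> Ck_on k S (pd e f)"
  by simp

lemma Ck_on_Suc_imp: "Ck_on (Suc k) S f \<Longrightarrow> Ck_on k S f"
  by (induction k arbitrary: f) auto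

lemma Ck_on_2_imp_1: "Ck_on 2 S f \<Longrightarrow> Ck_on 1 S f"
  using Ck_on_Suc_imp[of 1] by (simp add: numeral_2_eq_2)

lemma Ck_on_cong:
  assumes "open S" "\<And>q. q \<in> S \<Longrightarrow> f q = g q" "Ck_on k S f"
  shows "Ck_on k S g"
  using assms(2,3)
proof (induction k arbitrary: f g)
  case 0
  then show ?case
    using continuous_on_cong[of S S f g] by simp
next
  case (Suc k)
  have eq: "pd e f q = pd e g q" if "q \<in> S" for e q
    using assms(1) that Suc.prems(1) by (rule pd_cong)
  have "continuous_on S g"
    using Suc.prems continuous_on_cong[of S S f g] by simp
  moreover have "has_pd e g (pd e g q) q" if "e \<in> Basis" "q \<in> S" for e q
    using Ck_on_has_pd[OF Suc.prems(2) that] has_pd_cong[OF assms(1) that(2) Suc.prems(1)]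
      eq[OF that(2)]
    by simp
  moreover have "Ck_on k S (pd e g)" if "e \<in> Basis" for e
    using Suc.IH[OF eq Ck_on_pd[OF Suc.prems(2) that]] by blast
  ultimately show ?case
    by (simp add: has_pd_pd_iff)
qed

text \<open>Conjugation is known to commute with \<open>pd e\<close> only on \<open>S\<close>, where
  \<open>f\<close> is differentiable; \<open>Ck_on_cong\<close> bridges the gap in the
  induction.\<close>

lemma Ck_on_cnj:
  assumes "open S" "Ck_on k S f"
  shows "Ck_on k S (fun_cnj f)"
  using assms(2)
proof (induction k arbitrary: f)
  case 0
  then show ?case
    by (simp add: fun_cnj_def continuous_on_cnj)
next
  case (Suc k)
  have deriv: "has_pd e (fun_cnj f) (fun_cnj (pd e f) q) q" if "e \<in> Basis" "q \<in> S" for e q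
    using has_pd_cnj[OF Ck_on_has_pd[OF Suc.prems that]] by (simp add: fun_cnj_def)
  have "Ck_on k S (pd e (fun_cnj f))" if "e \<in> Basis" for e
  proof (rule Ck_on_cong[OF assms(1)])
    show "Ck_on k S (fun_cnj (pd e f))"
      using Suc.IH Ck_on_pd[OF Suc.prems that] by blast
    show "fun_cnj (pd e f) q = pd e (fun_cnj f) q" if "q \<in> S" for q
      using has_pd_imp_pd[OF deriv] \<open>e \<in> Basis\<close> that by simp
  qed
  moreover have "has_pd e (fun_cnj f) (pd e (fun_cnj f) q) q" if "e \<in> Basis" "q \<in> S" for e q
    using deriv[OF that] has_pd_imp_pd[OF deriv[OF that]] by simp
  moreover have "continuous_on S (fun_cnj f)"
    using Suc.prems by (simp add: fun_cnj_def continuous_on_cnj)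
  ultimately show ?case
    by (simp add: has_pd_pd_iff)
qed

lemma Ck_on_2_has_pd:
  assumes "Ck_on 2 S f" "e \<in> Basis" "d \<in> Basis" "p \<in> S"
  shows "has_pd d (pd e f) (pd d (pd e f) p) p"
  using Ck_on_has_pd[of 0 S "pd e f" d p] assms by (simp add: numeral_2_eq_2)

lemma Ck_on_2_pd_commute:
  assumes "open S" "Ck_on 2 S f" "a \<in> Basis" "b \<in> Basis" "p \<in> S"
  shows "pd a (pd b f) p = pd b (pd a f) p"
proof (rule mixed_pd_commute[OF assms(1,5)])
  show "continuous_on S (pd b (pd a f))" "continuous_on S (pd a (pd b f))"
    using assms by (auto simp: numeral_2_eq_2)
qed (use assms Ck_on_has_pd[OF Ck_on_2_imp_1[unfolded One_nat_def]] Ck_on_2_has_pd in blast)+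

subsection \<open>The operators \<open>D\<^sub>a\<close>, \<open>D\<^sub>b\<close> and their conjugates\<close>

text \<open>Allows an identity known only on \<open>S\<close> to be used underneath an outer
  operator.\<close>

lemma D_cong:
  assumes "open S" "p \<in> S" "\<And>q. q \<in> S \<Longrightarrow> f q = g q"
  shows "Da f p = Da g p" "Db f p = Db g p" "Da_star f p = Da_star g p"
  by (simp_all add: Da_def Db_def Da_star_def pd_cong[of S p f g, OF assms])

text \<open>Conjugation passes through the real partial derivatives and changes the sign of
  i.\<close>

lemma D_cnj:
  assumes "Ck_on 1 S f" "p \<in> S"
  shows "Da (fun_cnj f) p = cnj (Da_star f p)" "Da_star (fun_cnj f) p = cnj (Da f p)"
    and "Db (fun_cnj f) p = cnj (Db_star f p)" "Db_star (fun_cnj f) p = cnj (Db f p)"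
  using assms
  by (simp_all add: Da_def Da_star_def Db_def Db_star_def pd_cnj Basis_quat)

lemma op_cnj_D:
  assumes "Ck_on 1 S f" "p \<in> S"
  shows "op_cnj Da_star f p = Da f p" "op_cnj Db f p = Db_star f p"
    and "op_cnj (- Db) f p = - Db_star f p"
  using D_cnj[OF assms] by (simp_all add: op_cnj_def fun_cnj_def)

lemma has_pd_D:
  assumes "Ck_on 2 S f" "e \<in> Basis" "p \<in> S"
  shows "has_pd e (Da f) (pd e (pdx f) p + \<i> * pd e (pdy f) p) p"
    and "has_pd e (Da_star f) (pd e (pdx f) p - \<i> * pd e (pdy f) p) p"
    and "has_pd e (Db f) (pd e (pdz f) p + \<i> * pd e (pdu f) p) p"
    and "has_pd e (Db_star f) (pd e (pdz f) p - \<i> * pd e (pdu f) p) p"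
  unfolding Da_def[abs_def] Da_star_def[abs_def] Db_def[abs_def] Db_star_def[abs_def]
  using assms
  by (auto intro!: has_pd_add has_pd_diff has_pd_mult_left Ck_on_2_has_pd simp: Basis_quat)

text \<open>The sign may be moved out because the inner functions are differentiable along the
  coordinate directions, as second order smoothness of \<open>f\<close> ensures.\<close>

lemma D_minus:
  assumes "Ck_on 2 S f" "p \<in> S"
  shows "Db (\<lambda>q. - Da_star f q) p = - Db (Da_star f) p"
    and "Db (\<lambda>q. - Db_star f q) p = - Db (Db_star f) p"
    and "Db (\<lambda>q. - Da f q) p = - Db (Da f) p"
    and "Da (\<lambda>q. - Db f q) p = - Da (Db f) p"
    and "Da_star (\<lambda>q. - Db f q) p = - Da_star (Db f) p"
proof -
  have m: "pd e (\<lambda>q. - g q) p = - pd e g p" if "has_pd e g D p" for e D and g :: cfun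
    using has_pd_imp_pd[OF that] has_pd_imp_pd[OF has_pd_minus[OF that]] by simp
  note m = has_pd_D[OF assms(1) _ assms(2), THEN m]
  show "Db (\<lambda>q. - Da_star f q) p = - Db (Da_star f) p" "Db (\<lambda>q. - Db_star f q) p = - Db (Db_star f) p"
    "Db (\<lambda>q. - Da f q) p = - Db (Da f) p"
    "Da (\<lambda>q. - Db f q) p = - Da (Db f) p" "Da_star (\<lambda>q. - Db f q) p = - Da_star (Db f) p"
    \<comment> \<open>Only the outer operators are unfolded; the inner ones stay folded so that
      \<open>m\<close> matches.\<close>
    unfolding Db_def[of "\<lambda>q. - Da f q"] Db_def[of "Da f"] Db_def[of "\<lambda>q. - Da_star f q"] Db_def[of "\<lambda>q. - Db_star f q"] Db_def[of "Da_star f"]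
      Db_def[of "Db_star f"] Da_def[of "\<lambda>q. - Db f q"] Da_def[of "Db f"]
      Da_star_def[of "\<lambda>q. - Db f q"] Da_star_def[of "Db f"]
    by (simp_all add: m Basis_quat)
qed

lemma Da_Db_commute:
  assumes "open S" "Ck_on 2 S f" "p \<in> S"
  shows "Da (Db f) p = Db (Da f) p" "Da_star (Db f) p = Db (Da_star f) p"
proof -
  note c = Ck_on_2_pd_commute[OF assms(1,2) _ _ assms(3)]
  note d = has_pd_D[OF assms(2) _ assms(3), THEN has_pd_imp_pd]
  have "pd (1, 0) (pdz f) p = pd (0, 1) (pdx f) p" "pd (1, 0) (pdu f) p = pd (0, \<i>) (pdx f) p"
    "pd (\<i>, 0) (pdz f) p = pd (0, 1) (pdy f) p" "pd (\<i>, 0) (pdu f) p = pd (0, \<i>) (pdy f) p"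
    by (simp_all add: c Basis_quat)
  then show "Da (Db f) p = Db (Da f) p" "Da_star (Db f) p = Db (Da_star f) p"
    unfolding Da_def[of "Db f"] Da_star_def[of "Db f"] Db_def[of "Da f"] Db_def[of "Da_star f"]
    by (simp_all add: d Basis_quat) (simp_all add: algebra_simps)
qed

text \<open>Expanding the products yields the pure second derivatives and i times differences of
  mixed ones, which vanish by symmetry.\<close>

lemma laplace4_factorization:
  assumes "open S" "Ck_on 2 S f" "p \<in> S"
  shows "Da (Da_star f) p + Db (Db_star f) p = laplace4 f p"
    and "Da_star (Da f) p + Db (Db_star f) p = laplace4 f p"
proof -
  note c = Ck_on_2_pd_commute[OF assms(1,2) _ _ assms(3)]
  note d = has_pd_D[OF assms(2) _ assms(3), THEN has_pd_imp_pd]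
  have "pd (\<i>, 0) (pdx f) p = pd (1, 0) (pdy f) p" "pd (0, \<i>) (pdz f) p = pd (0, 1) (pdu f) p"
    by (simp_all add: c Basis_quat)
  then show "Da (Da_star f) p + Db (Db_star f) p = laplace4 f p"
    "Da_star (Da f) p + Db (Db_star f) p = laplace4 f p"
    unfolding Da_def[of "Da_star f"] Da_star_def[of "Da f"] Db_def[of "Db_star f"] laplace4_def
    by (simp_all add: d Basis_quat) (simp_all add: algebra_simps)
qed

subsection \<open>Factorization and first order systems\<close>

text \<open>Conjugating \<open>- Db\<close> turns the minus sign of the first entry into a plus,
  giving the Laplacian; the second entry is the commutator of \<open>Db\<close> and
  \<open>Da\<close>, hence zero.\<close>

lemma laplace4_eq_Lq_Lq_star:
  assumes "open S"
  shows "op_eq_on S laplace4_pair (Lq \<times>\<^sub>o Lq_star)"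
proof -
  have "laplace4 f p = Da (Da_star f) p - Db (op_cnj (- Db) f) p \<and>
      0 = Db (op_cnj Da_star f) p + Da ((- Db) f) p"
    if f: "Ck_on 2 S f" and p: "p \<in> S" for f p
  proof -
    note f1 = Ck_on_2_imp_1[OF f]
    have "Db (op_cnj (- Db) f) p = - Db (Db_star f) p"
      using D_cong(2)[OF assms p, of "op_cnj (- Db) f" "\<lambda>q. - Db_star f q"]
      by (simp add: op_cnj_D[OF f1] D_minus[OF f p])
    moreover have "Db (op_cnj Da_star f) p = Db (Da f) p"
      by (rule D_cong(2)[OF assms p]) (rule op_cnj_D[OF f1])
    moreover have "Da ((- Db) f) p = - Da (Db f) p"
      using D_minus(4)[OF f p] by (simp add: fun_Compl_def)
    ultimately show ?thesis
      by (simp add: laplace4_factorization[OF assms f p] Da_Db_commute[OF assms f p])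
  qed
  then show ?thesis
    by (simp add: op_eq_on_def laplace4_pair_def op_op_mult_def Lq_def Lq_star_def)
qed

text \<open>Here the plus sign of the first entry comes from the left factor \<open>- Db\<close>,
  and the second entry is the commutator of \<open>Da_star\<close> and \<open>Db\<close>.\<close>

lemma laplace4_eq_Lq_star_Lq:
  assumes "open S"
  shows "op_eq_on S laplace4_pair (Lq_star \<times>\<^sub>o Lq)"
proof -
  have "laplace4 f p = Da_star (Da f) p + Db (op_cnj Db f) p \<and>
      0 = Da_star (Db f) p - Db (op_cnj Da f) p"
    if f: "Ck_on 2 S f" and p: "p \<in> S" for f p
  proof -
    note f1 = Ck_on_2_imp_1[OF f]
    have "Db (op_cnj Db f) p = Db (Db_star f) p"
      by (rule D_cong(2)[OF assms p]) (rule op_cnj_D[OF f1])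
    moreover have "Db (op_cnj Da f) p = Db (Da_star f) p"
      by (rule D_cong(2)[OF assms p]) (rule op_cnj_Da[OF f1])
    ultimately show ?thesis
      by (simp add: laplace4_factorization[OF assms f p] Da_Db_commute[OF assms f p])
  qed
  then show ?thesis
    by (simp add: op_eq_on_def laplace4_pair_def op_op_mult_def Lq_def Lq_star_def)
qed

lemma zero_on_Lq_iff:
  "zero_on S (Lq \<times>\<^sub>f (f, g)) \<longleftrightarrow>
    (\<forall>p\<in>S. Da f p = Db (fun_cnj g) p \<and> Db (fun_cnj f) p = - Da g p)"
  by (simp add: zero_on_def op_fun_mult_def Lq_def eq_neg_iff_add_eq_0)

lemma zero_on_Lq_star_iff:
  "zero_on S (Lq_star \<times>\<^sub>f (f, g)) \<longleftrightarrow>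
    (\<forall>p\<in>S. Da_star f p = - Db (fun_cnj g) p \<and> Db (fun_cnj f) p = Da_star g p)"
  by (auto simp: zero_on_def op_fun_mult_def Lq_star_def eq_neg_iff_add_eq_0)

section \<open>Harmonicity of solutions of the first order systems\<close>

text \<open>For each component, \<open>Da_star\<close> is applied to one equation and
  \<open>Db\<close> to the conjugate of the other. By commutation the two results are opposite, and
  their sum is the Laplacian.\<close>

lemma zero_on_Lq_imp_laplace4:
  assumes S: "open S" and f: "Ck_on 2 S f" and g: "Ck_on 2 S g"
    and "zero_on S (Lq \<times>\<^sub>f (f, g))" and p: "p \<in> S"
  shows "laplace4 f p = 0" "laplace4 g p = 0"
proof -
  note fc = Ck_on_cnj[OF S f] and gc = Ck_on_cnj[OF S g]
  note f1 = Ck_on_2_imp_1[OF f] and g1 = Ck_on_2_imp_1[OF g]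
  have 1: "Da f q = Db (fun_cnj g) q" and 2: "Da g q = - Db (fun_cnj f) q" if "q \<in> S" for q
    using assms(4) that by (simp_all add: zero_on_Lq_iff)
  \<comment> \<open>These are the conjugated equations: 3 comes from 2, and 4 comes from 1.\<close>
  have 3: "Db_star f q = - Da_star (fun_cnj g) q" and 4: "Db_star g q = Da_star (fun_cnj f) q"
    if "q \<in> S" for q
    using 1[OF that] 2[OF that] D_cnj[OF f1 that] D_cnj[OF g1 that]
    by (metis complex_cnj_cnj complex_cnj_minus minus_minus)+
  have "Da_star (Da f) p = Db (Da_star (fun_cnj g)) p"
    using D_cong(3)[OF S p 1] Da_Db_commute(2)[OF S gc p] by simp
  moreover have "Db (Db_star f) p = - Db (Da_star (fun_cnj g)) p"
    using D_cong(2)[OF S p 3] D_minus(1)[OF gc p] by simp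
  ultimately show "laplace4 f p = 0"
    by (simp flip: laplace4_factorization(2)[OF S f p])
  have "Da_star (Da g) p = - Db (Da_star (fun_cnj f)) p"
    using D_cong(3)[OF S p 2] D_minus(5)[OF fc p] Da_Db_commute(2)[OF S fc p] by simp
  moreover have "Db (Db_star g) p = Db (Da_star (fun_cnj f)) p"
    using D_cong(2)[OF S p 4] by simp
  ultimately show "laplace4 g p = 0"
    by (simp flip: laplace4_factorization(2)[OF S g p])
qed

text \<open>The same cancellation with \<open>Da\<close> and \<open>Da_star\<close> exchanged, now
  through the first form of the factorization.\<close>

lemma zero_on_Lq_star_imp_laplace4:
  assumes S: "open S" and f: "Ck_on 2 S f" and g: "Ck_on 2 S g"
    and "zero_on S (Lq_star \<times>\<^sub>f (f, g))" and p: "p \<in> S"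
  shows "laplace4 f p = 0" "laplace4 g p = 0"
proof -
  note fc = Ck_on_cnj[OF S f] and gc = Ck_on_cnj[OF S g]
  note f1 = Ck_on_2_imp_1[OF f] and g1 = Ck_on_2_imp_1[OF g]
  have 1: "Da_star f q = - Db (fun_cnj g) q" and 2: "Da_star g q = Db (fun_cnj f) q" if "q \<in> S" for q
    using assms(4) that by (simp_all add: zero_on_Lq_star_iff)
  have 3: "Db_star f q = Da (fun_cnj g) q" and 4: "Db_star g q = - Da (fun_cnj f) q"
    if "q \<in> S" for q
    using 1[OF that] 2[OF that] D_cnj[OF f1 that] D_cnj[OF g1 that]
    by (metis complex_cnj_cnj complex_cnj_minus minus_minus)+
  have "Da (Da_star f) p = - Db (Da (fun_cnj g)) p"
    using D_cong(1)[OF S p 1] D_minus(4)[OF gc p] Da_Db_commute(1)[OF S gc p] by simp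
  moreover have "Db (Db_star f) p = Db (Da (fun_cnj g)) p"
    using D_cong(2)[OF S p 3] by simp
  ultimately show "laplace4 f p = 0"
    by (simp flip: laplace4_factorization(1)[OF S f p])
  have "Da (Da_star g) p = Db (Da (fun_cnj f)) p"
    using D_cong(1)[OF S p 2] Da_Db_commute(1)[OF S fc p] by simp
  moreover have "Db (Db_star g) p = - Db (Da (fun_cnj f)) p"
    using D_cong(2)[OF S p 4] D_minus(3)[OF fc p] by simp
  ultimately show "laplace4 g p = 0"
    by (simp flip: laplace4_factorization(1)[OF S g p])
qed

text \<open>Links the Laplace equation for the quaternion-valued function to its components. The
  inner derivative splits on all of \<open>S\<close>, so locality permits differentiating the split
  form again.\<close>

lemma pd_pd_Pair:
  assumes "open S" "Ck_on 2 S f" "Ck_on 2 S g" "e \<in> Basis" "p \<in> S"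
  shows "pd e (pd e (\<lambda>q. (f q, g q))) p = (pd e (pd e f) p, pd e (pd e g) p)"
proof -
  have "pd e (\<lambda>q. (f q, g q)) q = (pd e f q, pd e g q)" if "q \<in> S" for q
    using assms that
    by (intro has_pd_imp_pd has_pd_Pair Ck_on_has_pd[OF Ck_on_2_imp_1[unfolded One_nat_def]])
  then have "pd e (pd e (\<lambda>q. (f q, g q))) p = pd e (\<lambda>q. (pd e f q, pd e g q)) p"
    using assms(1,5) by (intro pd_cong) auto
  also have "\<dots> = (pd e (pd e f) p, pd e (pd e g) p)"
    using assms by (intro has_pd_imp_pd has_pd_Pair Ck_on_2_has_pd)
  finally show ?thesis .
qed

theorem mainTheorem10:
  fixes S :: "quat set"
  assumes "open S"
  shows "op_eq_on S laplace4_pair (Lq \<times>\<^sub>o Lq_star) \<and>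
    op_eq_on S laplace4_pair (Lq_star \<times>\<^sub>o Lq) \<and>
    (\<forall>\<phi>1 \<phi>2. Ck_on 2 S \<phi>1 \<and> Ck_on 2 S \<phi>2 \<longrightarrow>
       zero_on S (Lq \<times>\<^sub>f (\<phi>1, \<phi>2)) \<or> zero_on S (Lq_star \<times>\<^sub>f (\<phi>1, \<phi>2)) \<longrightarrow>
         zero_on S (laplace4_pair \<times>\<^sub>f (\<phi>1, \<phi>2)) \<and>
         (let \<psi> = (\<lambda>p. (\<phi>1 p, \<phi>2 p)) in
            \<forall>p\<in>S. pdx (pdx \<psi>) p + pdy (pdy \<psi>) p + pdz (pdz \<psi>) p + pdu (pdu \<psi>) p = 0)) \<and>
    (\<forall>\<phi>1 \<phi>2. Ck_on 1 S \<phi>1 \<and> Ck_on 1 S \<phi>2 \<longrightarrow>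
       (zero_on S (Lq \<times>\<^sub>f (\<phi>1, \<phi>2)) \<longleftrightarrow>
         (\<forall>p\<in>S. Da \<phi>1 p = Db (fun_cnj \<phi>2) p \<and> Db (fun_cnj \<phi>1) p = - Da \<phi>2 p)) \<and>
       (zero_on S (Lq_star \<times>\<^sub>f (\<phi>1, \<phi>2)) \<longleftrightarrow>
         (\<forall>p\<in>S. Da_star \<phi>1 p = - Db (fun_cnj \<phi>2) p \<and> Db (fun_cnj \<phi>1) p = Da_star \<phi>2 p)))"
proof -
  have harmonic: "zero_on S (laplace4_pair \<times>\<^sub>f (f, g)) \<and>
      (let \<psi> = (\<lambda>p. (f p, g p)) in
        \<forall>p\<in>S. pdx (pdx \<psi>) p + pdy (pdy \<psi>) p + pdz (pdz \<psi>) p + pdu (pdu \<psi>) p = 0)"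
    if fg: "Ck_on 2 S f" "Ck_on 2 S g"
      and zero: "zero_on S (Lq \<times>\<^sub>f (f, g)) \<or> zero_on S (Lq_star \<times>\<^sub>f (f, g))" for f g
  proof -
    \<comment> \<open>Both versions of the conclusion, for the operator pair and for the pair-valued
      function, reduce to the harmonicity of the two components.\<close>
    have laplace: "laplace4 f p = 0" "laplace4 g p = 0" if "p \<in> S" for p
      using zero zero_on_Lq_imp_laplace4[OF assms fg _ that]
        zero_on_Lq_star_imp_laplace4[OF assms fg _ that] by blast+
    then have "zero_on S (laplace4_pair \<times>\<^sub>f (f, g))"
      by (simp add: zero_on_def op_fun_mult_def laplace4_pair_def)
    moreover have "pdx (pdx \<psi>) p + pdy (pdy \<psi>) p + pdz (pdz \<psi>) p + pdu (pdu \<psi>) p = 0"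
      if "p \<in> S" "\<psi> = (\<lambda>p. (f p, g p))" for p \<psi>
      using laplace[OF that(1)]
      by (simp add: that(2) pd_pd_Pair[OF assms fg _ that(1)] Basis_quat laplace4_def zero_prod_def)
    ultimately show ?thesis
      by (simp add: Let_def)
  qed
  show ?thesis
    using laplace4_eq_Lq_Lq_star[OF assms] laplace4_eq_Lq_star_Lq[OF assms] harmonic
    by (simp add: zero_on_Lq_iff zero_on_Lq_star_iff)
qed

end
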